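(* Let $I\subset\mathbb{R}$ be an interval, let $f:I\to\mathbb{R}$ be differentiable on the interior $I^{\circ}$ with $f'\in L[a,b]$, where $a,b\in I^{\circ}$, $a<b$, and let $\alpha,\lambda\in[0,1]$. Let $q>1$ and let $p$ satisfy $\frac1p+\frac1q=1$. If $|f'|^{q}$ is quasi-convex on $[a,b]$, then $$\left|\lambda\left(\alpha f(a)+(1-\alpha)f(b)\right)+(1-\lambda)f(\alpha a+(1-\alpha)b)-\frac{1}{b-a}\int_a^b f(x)\,dx\right|$$ $$\le (b-a)\left(\frac{1}{p+1}\right)^{1/p}A^{1/q}\cdot\begin{cases}(1-\alpha)^{1/q}\varepsilon_1^{1/p}+\alpha^{1/q}\varepsilon_3^{1/p}, & \alpha\lambda\le 1-\alpha\le 1-\lambda(1-\alpha),\\ (1-\alpha)^{1/q}\varepsilon_1^{1/p}+\alpha^{1/q}\varepsilon_4^{1/p}, & \alpha\lambda\le 1-\lambda(1-\alpha)\le 1-\alpha,\\ (1-\alpha)^{1/q}\varepsilon_2^{1/p}+\alpha^{1/q}\varepsilon_3^{1/p}, & 1-\alpha\le\alpha\lambda\le 1-\lambda(1-\alpha),\end{cases}$$ where $A=\sup\{|f'(a)|^q,|f'(b)|^q\}$ and $$\varepsilon_1=(\alpha\lambda)^{p+1}+(1-\alpha-\alpha\lambda)^{p+1},\qquad \varepsilon_2=(\alpha\lambda)^{p+1}-(\alpha\lambda-1+\alpha)^{p+1},$$ $$\varepsilon_3=[\lambda(1-\alpha)]^{p+1}+[\alpha-\lambda(1-\alpha)]^{p+1},\qquad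 \varepsilon_4=[\lambda(1-\alpha)]^{p+1}-[\lambda(1-\alpha)-\alpha]^{p+1}.$$
   Context: A function $g:[a,b]\to\mathbb{R}$ is quasi-convex on $[a,b]$ if $g(tx+(1-t)y)\le\sup\{g(x),g(y)\}$ for all $x,y\in[a,b]$ and $t\in[0,1]$. $L[a,b]$ denotes the set of Lebesgue integrable functions on $[a,b]$. Each $\varepsilon_i$ is only used in the cases where the bases of its powers are nonnegative. *)

theory Defs
  imports "HOL-Analysis.Analysis"
begin

definition quasi_convex_on :: "real set \<Rightarrow> (real \<Rightarrow> real) \<Rightarrow> bool" where
  "quasi_convex_on S g \<longleftrightarrow>
     (\<forall>x\<in>S. \<forall>y\<in>S. \<forall>t\<in>{0..1}. g (t * x + (1 - t) * y) \<le> Sup {g x, g y})"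

text \<open>
  The exponents are real, so the powers below are meaningful only for nonnegative bases:
  \<open>\<epsilon>\<^sub>1\<close> is to be used for \<open>\<alpha> \<mu> \<le> 1 - \<alpha>\<close>, \<open>\<epsilon>\<^sub>2\<close> for \<open>1 - \<alpha> \<le> \<alpha> \<mu>\<close>, \<open>\<epsilon>\<^sub>3\<close> for
  \<open>\<mu> (1 - \<alpha>) \<le> \<alpha>\<close> and \<open>\<epsilon>\<^sub>4\<close> for \<open>\<alpha> \<le> \<mu> (1 - \<alpha>)\<close>. The parameter usually written
  as a lambda is called \<open>\<mu>\<close>.
\<close>

definition \<epsilon>\<^sub>1 :: "real \<Rightarrow> real \<Rightarrow> real \<Rightarrow> real" where
  "\<epsilon>\<^sub>1 \<alpha> \<mu> p = (\<alpha> * \<mu>) powr (p + 1) + (1 - \<alpha> - \<alpha> * \<mu>) powr (p + 1)"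

definition \<epsilon>\<^sub>2 :: "real \<Rightarrow> real \<Rightarrow> real \<Rightarrow> real" where
  "\<epsilon>\<^sub>2 \<alpha> \<mu> p = (\<alpha> * \<mu>) powr (p + 1) - (\<alpha> * \<mu> - 1 + \<alpha>) powr (p + 1)"

definition \<epsilon>\<^sub>3 :: "real \<Rightarrow> real \<Rightarrow> real \<Rightarrow> real" where
  "\<epsilon>\<^sub>3 \<alpha> \<mu> p = (\<mu> * (1 - \<alpha>)) powr (p + 1) + (\<alpha> - \<mu> * (1 - \<alpha>)) powr (p + 1)"

definition \<epsilon>\<^sub>4 :: "real \<Rightarrow> real \<Rightarrow> real \<Rightarrow> real" where
  "\<epsilon>\<^sub>4 \<alpha> \<mu> p = (\<mu> * (1 - \<alpha>)) powr (p + 1) - (\<mu> * (1 - \<alpha>) - \<alpha>) powr (p + 1)"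

end

theory Submission
  imports Defs
begin

text \<open>
  Quasi-convexity bounds \<open>\<bar>f'\<bar>\<close> on \<open>[a, b]\<close> by \<open>M = A powr (1/q)\<close>, so \<open>f\<close> is \<open>M\<close>-Lipschitz there.
  Comparing \<open>f\<close> with its values at the three nodes then bounds the error of the rule by
  \<open>(b - a) * M\<close> times the sum of \<open>\<integral>\<^sub>0\<^sup>c \<bar>t - s\<bar> dt\<close> over \<open>(s, c) = (\<alpha> \<mu>, 1 - \<alpha>)\<close> and
  \<open>(s, c) = (\<mu> (1 - \<alpha>), \<alpha>)\<close>, and Hoelder's inequality estimates each of these integrals.
  To avoid integrating real powers, the latter step integrates the tangent-line form of Young's
  inequality, \<open>x \<le> k powr (1 - p) * x powr p / p + k / q\<close>, by monotonicity of a primitive,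
  and then optimises over \<open>k\<close>.
\<close>

section \<open>Hoelder estimates for the integral of a distance, via Young's inequality\<close>

text \<open>The right side is convex in \<open>x\<close> and touches the line \<open>x\<close> at
  \<open>x = k\<close>. The two factors fed to Young's inequality are scaled so that their product
  is \<open>x\<close>.\<close>

lemma young_tangent:
  fixes p q k x :: real
  assumes "p > 1" "1 / p + 1 / q = 1" "k > 0" "x > 0"
  shows "x \<le> k powr (1 - p) * x powr p / p + k / q"
proof -
  have "0 < 1 / p" "1 / p < 1" using assms(1) by auto
  then have "0 < 1 / q" "1 / q < 1" using assms(2) by linarith+
  then have q: "q > 1" by (simp add: divide_simps split: if_splits)
  have inv_q: "1 / q = 1 - 1 / p" using assms(2) by linarith
  have "(k powr (1 / p - 1) * x) * k powr (1 / q)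
      \<le> (k powr (1 / p - 1) * x) powr p / p + (k powr (1 / q)) powr q / q"
    using assms q by (intro Youngs_inequality) auto
  moreover have "(k powr (1 / p - 1) * x) * k powr (1 / q) = x"
    using assms by (simp add: inv_q powr_diff)
  moreover have "(k powr (1 / p - 1) * x) powr p = k powr (1 - p) * x powr p"
    using assms by (simp add: powr_mult powr_powr left_diff_distrib)
  moreover have "(k powr (1 / q)) powr q = k"
    using assms q by (simp add: powr_powr)
  ultimately show ?thesis by simp
qed

text \<open>The function compared at \<open>x\<close> and \<open>y\<close> is a primitive of the
  defect in \<open>young_tangent\<close>. Its derivative is taken only at interior points, which are
  positive, so \<open>x = 0\<close> is allowed.\<close>

lemma young_primitive_mono:
  fixes p q k x y :: real
  assumes "p > 1" "1 / p + 1 / q = 1" "k > 0" "0 \<le> x" "x \<le> y"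
  shows "k powr (1 - p) * x powr (p + 1) / (p * (p + 1)) + x * k / q - x\<^sup>2 / 2
       \<le> k powr (1 - p) * y powr (p + 1) / (p * (p + 1)) + y * k / q - y\<^sup>2 / 2"
    (is "?h x \<le> ?h y")
proof (rule DERIV_nonneg_imp_increasing_open[OF \<open>x \<le> y\<close>])
  fix z assume z: "x < z" "z < y"
  have "(?h has_real_derivative
      k powr (1 - p) * ((p + 1) * z powr (p + 1 - 1)) / (p * (p + 1)) + k / q - z) (at z)"
    using assms z by (auto intro!: derivative_eq_intros simp: powr_diff)
  moreover have "k powr (1 - p) * ((p + 1) * z powr (p + 1 - 1)) / (p * (p + 1))
      = k powr (1 - p) * z powr p / p"
    using assms by (simp add: divide_simps)
  ultimately show "\<exists>d. (?h has_real_derivative d) (at z) \<and> d \<ge> 0"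
    using young_tangent[OF assms(1-3), of z] assms z by force
next
  show "continuous_on {x..y} ?h"
    using assms by (intro continuous_intros continuous_on_powr') auto
qed

text \<open>The optimisation over \<open>k\<close>: choosing the best parameter turns the family of
  Young bounds into the Hoelder bound.\<close>

lemma le_powr_of_young_bounds:
  fixes p q c E F :: real
  assumes p: "p > 1" "1 / p + 1 / q = 1" and "c > 0" "E > 0"
    and F: "\<And>k. k > 0 \<Longrightarrow> F \<le> k powr (1 - p) * E / (p * (p + 1)) + c * k / q"
  shows "F \<le> (1 / (p + 1)) powr (1 / p) * (c powr (1 / q) * E powr (1 / p))"
proof -
  \<comment> \<open>The minimiser of the bound. There the first term equals
    \<open>c * k / p\<close>, so the two terms add up to \<open>c * k\<close>.\<close>
  define k where "k = (E / ((p + 1) * c)) powr (1 / p)"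
  have k: "k > 0" using assms by (simp add: k_def)
  have "k powr p = E / ((p + 1) * c)"
    using assms by (simp add: k_def powr_powr)
  then have E: "E = (p + 1) * c * k powr p" using assms by simp
  have "k powr (1 - p) * k powr p = k" using k by (simp flip: powr_add)
  then have "k powr (1 - p) * E / (p * (p + 1)) = c * k / p"
    using assms by (simp add: E divide_simps)
  then have "F \<le> c * k * (1 / p + 1 / q)"
    using F[OF k] by (simp add: algebra_simps)
  also have "\<dots> = c * k" using p by simp
  also have "c * k = (1 / (p + 1)) powr (1 / p) * (c powr (1 - 1 / p) * E powr (1 / p))"
    using assms by (simp add: k_def powr_divide powr_mult powr_diff)
  also have "1 - 1 / p = 1 / q" using p by simp
  finally show ?thesis .
qed

text \<open>
  For \<open>s \<le> c\<close> here, and for \<open>c \<le> s\<close> in the next lemma, this is the Hoelder inequality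
  \<open>\<integral>\<^sub>0\<^sup>c \<bar>t - s\<bar> dt \<le> c powr (1/q) * (\<integral>\<^sub>0\<^sup>c \<bar>t - s\<bar> powr p dt) powr (1/p)\<close>
  with both integrals evaluated.
\<close>
lemma holder_abs_inside:
  fixes p q s c :: real
  assumes p: "p > 1" "1 / p + 1 / q = 1" and "0 \<le> s" "s \<le> c"
  shows "(s\<^sup>2 + (c - s) * \<bar>c - s\<bar>) / 2 \<le> (1 / (p + 1)) powr (1 / p) *
           (c powr (1 / q) * (s powr (p + 1) + (c - s) powr (p + 1)) powr (1 / p))"
proof (cases "c = 0")
  case True
  then show ?thesis using assms by simp
next
  case False
  show ?thesis
  proof (rule le_powr_of_young_bounds[OF p])
    have "s powr (p + 1) > 0 \<or> (c - s) powr (p + 1) > 0"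
      using False assms by auto
    then show "s powr (p + 1) + (c - s) powr (p + 1) > 0"
      by (smt (verit) powr_ge_zero)
  next
    fix k :: real assume k: "k > 0"
    \<comment> \<open>An increment of the primitive starting at 0, to be used on either side of the
      kink: the pieces have lengths \<open>s\<close> and \<open>c - s\<close>.\<close>
    have young: "z\<^sup>2 / 2 \<le> k powr (1 - p) * z powr (p + 1) / (p * (p + 1)) + z * k / q"
      if "z \<ge> 0" for z
      using young_primitive_mono[OF p k, of 0 z] that by simp
    have "k powr (1 - p) * (s powr (p + 1) + (c - s) powr (p + 1)) / (p * (p + 1))
        = k powr (1 - p) * s powr (p + 1) / (p * (p + 1))
          + k powr (1 - p) * (c - s) powr (p + 1) / (p * (p + 1))"
      by (simp add: right_diff_distrib distrib_left add_divide_distrib diff_divide_distrib)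
    moreover have "(c - s) * k / q = c * k / q - s * k / q"
      by (simp add: left_diff_distrib diff_divide_distrib)
    moreover have "(s\<^sup>2 + (c - s) * \<bar>c - s\<bar>) / 2 = s\<^sup>2 / 2 + (c - s)\<^sup>2 / 2"
      using assms by (simp add: power2_eq_square algebra_simps add_divide_distrib diff_divide_distrib)
    ultimately show "(s\<^sup>2 + (c - s) * \<bar>c - s\<bar>) / 2
        \<le> k powr (1 - p) * (s powr (p + 1) + (c - s) powr (p + 1)) / (p * (p + 1)) + c * k / q"
      using young[of s] young[of "c - s"] assms by linarith
  qed (use False assms in auto)
qed

lemma holder_abs_outside:
  fixes p q s c :: real
  assumes p: "p > 1" "1 / p + 1 / q = 1" and "0 \<le> c" "c \<le> s"
  shows "(s\<^sup>2 + (c - s) * \<bar>c - s\<bar>) / 2 \<le> (1 / (p + 1)) powr (1 / p) *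
           (c powr (1 / q) * (s powr (p + 1) - (s - c) powr (p + 1)) powr (1 / p))"
proof (cases "c = 0")
  case True
  then show ?thesis using assms by (simp add: power2_eq_square)
next
  case False
  show ?thesis
  proof (rule le_powr_of_young_bounds[OF p])
    show "s powr (p + 1) - (s - c) powr (p + 1) > 0"
      using False assms by (simp add: powr_less_mono2)
  next
    fix k :: real assume k: "k > 0"
    have "k powr (1 - p) * (s powr (p + 1) - (s - c) powr (p + 1)) / (p * (p + 1))
        = k powr (1 - p) * s powr (p + 1) / (p * (p + 1))
          - k powr (1 - p) * (s - c) powr (p + 1) / (p * (p + 1))"
      by (simp add: right_diff_distrib distrib_left add_divide_distrib diff_divide_distrib)
    moreover have "(s - c) * k / q = s * k / q - c * k / q"
      by (simp add: left_diff_distrib diff_divide_distrib)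
    \<comment> \<open>The distance from \<open>s\<close> to points of \<open>{0..c}\<close> runs
      through \<open>{s - c..s}\<close>, so a single increment of the primitive suffices.\<close>
    moreover have "(s\<^sup>2 + (c - s) * \<bar>c - s\<bar>) / 2 = s\<^sup>2 / 2 - (s - c)\<^sup>2 / 2"
      using assms by (simp add: power2_eq_square algebra_simps add_divide_distrib diff_divide_distrib)
    ultimately show "(s\<^sup>2 + (c - s) * \<bar>c - s\<bar>) / 2
        \<le> k powr (1 - p) * (s powr (p + 1) - (s - c) powr (p + 1)) / (p * (p + 1)) + c * k / q"
      using young_primitive_mono[OF p k, of "s - c" s] assms
      by linarith
  qed (use False assms in auto)
qed

section \<open>Error of the three-point rule for a Lipschitz function\<close>

text \<open>The signed square \<open>(t - y) * \<bar>t - y\<bar> / 2\<close> is a primitive wherever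
  \<open>y\<close> lies relative to \<open>{u..v}\<close>. The proof treats \<open>y\<close> as an
  exceptional point of the fundamental theorem.\<close>

lemma has_integral_abs_diff:
  fixes u v y :: real
  assumes "u \<le> v"
  shows "((\<lambda>t. \<bar>t - y\<bar>) has_integral ((v - y) * \<bar>v - y\<bar> - (u - y) * \<bar>u - y\<bar>) / 2) {u..v}"
proof -
  have "((\<lambda>t. \<bar>t - y\<bar>) has_integral
      ((v - y) * \<bar>v - y\<bar> / 2 - (u - y) * \<bar>u - y\<bar> / 2)) {u..v}"
  proof (rule fundamental_theorem_of_calculus_interior_strong[where S = "{y}"])
    fix t assume "t \<in> {u<..<v} - {y}"
    then consider "t < y" | "t > y" by fastforce
    then have "((\<lambda>t. (t - y) * \<bar>t - y\<bar> / 2) has_real_derivative \<bar>t - y\<bar>) (at t)"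
    proof cases
      case 1
      have "((\<lambda>t. - ((t - y)\<^sup>2 / 2)) has_real_derivative \<bar>t - y\<bar>) (at t)"
        using 1 by (auto intro!: derivative_eq_intros simp: field_simps)
      then show ?thesis
        by (rule has_field_derivative_transform_within_open[where S = "{..<y}"])
          (use 1 in \<open>auto simp: power2_eq_square field_simps\<close>)
    next
      case 2
      have "((\<lambda>t. (t - y)\<^sup>2 / 2) has_real_derivative \<bar>t - y\<bar>) (at t)"
        using 2 by (auto intro!: derivative_eq_intros)
      then show ?thesis
        by (rule has_field_derivative_transform_within_open[where S = "{y<..}"])
          (use 2 in \<open>auto simp: power2_eq_square\<close>)
    qed
    then show "((\<lambda>t. (t - y) * \<bar>t - y\<bar> / 2) has_vector_derivative \<bar>t - y\<bar>) (at t)"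
      by (simp add: has_real_derivative_iff_has_vector_derivative)
  qed (use assms in \<open>auto intro!: continuous_intros\<close>)
  then show ?thesis by (simp add: diff_divide_distrib)
qed

text \<open>Integrates the pointwise Lipschitz bound. The node \<open>y\<close> may lie outside
  \<open>{u..v}\<close>, as can happen for the middle piece of the rule.\<close>

lemma lipschitz_integral_diff_le:
  fixes f :: "real \<Rightarrow> real"
  assumes lip: "\<And>s t. s \<in> {a..b} \<Longrightarrow> t \<in> {a..b} \<Longrightarrow> \<bar>f s - f t\<bar> \<le> M * \<bar>s - t\<bar>"
    and f: "f integrable_on {u..v}"
    and "a \<le> u" "u \<le> v" "v \<le> b" "y \<in> {a..b}"
  shows "\<bar>(v - u) * f y - integral {u..v} f\<bar>
       \<le> M * (((v - y) * \<bar>v - y\<bar> - (u - y) * \<bar>u - y\<bar>) / 2)"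
proof -
  let ?B = "M * (((v - y) * \<bar>v - y\<bar> - (u - y) * \<bar>u - y\<bar>) / 2)"
  have g: "((\<lambda>t. f y - f t) has_integral ((v - u) * f y - integral {u..v} f)) {u..v}"
    using has_integral_diff[OF has_integral_const_real[of "f y" u v] integrable_integral[OF f]]
      \<open>u \<le> v\<close> by simp
  have h: "((\<lambda>t. M * \<bar>t - y\<bar>) has_integral ?B) {u..v}"
    by (intro has_integral_mult_right has_integral_abs_diff assms)
  have "norm (integral {u..v} (\<lambda>t. f y - f t)) \<le> integral {u..v} (\<lambda>t. M * \<bar>t - y\<bar>)"
  proof (rule integral_norm_bound_integral)
    fix t assume "t \<in> {u..v}"
    then show "norm (f y - f t) \<le> M * \<bar>t - y\<bar>"
      using lip[of y t] assms by (simp add: abs_minus_commute)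
  qed (use g h in \<open>auto simp: has_integral_iff\<close>)
  then show ?thesis unfolding integral_unique[OF g] integral_unique[OF h] by simp
qed

lemma quasi_convex_on_le_Sup_endpoints:
  assumes "quasi_convex_on {a..b} g" "x \<in> {a..b}"
  shows "g x \<le> Sup {g a, g b}"
proof -
  have "x \<in> closed_segment a b" using assms by (simp add: closed_segment_eq_real_ivl)
  then obtain u where u: "0 \<le> u" "u \<le> 1" "x = (1 - u) * a + u * b"
    by (auto simp: in_segment)
  moreover have "g ((1 - u) * a + (1 - (1 - u)) * b) \<le> Sup {g a, g b}"
    using assms(1)[unfolded quasi_convex_on_def, rule_format, of a b "1 - u"] assms(2) u(1,2)
    by simp
  ultimately show ?thesis by simp
qed

text \<open>
  The weights \<open>\<mu> \<alpha>\<close>, \<open>1 - \<mu>\<close>, \<open>\<mu> (1 - \<alpha>)\<close> of the rule cut \<open>[a, b]\<close>, in this order, into three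
  pieces, and each piece is compared with its own node.
\<close>
lemma lipschitz_three_point_bound:
  fixes f :: "real \<Rightarrow> real" and a b \<alpha> \<mu> M :: real
  assumes lip: "\<And>s t. s \<in> {a..b} \<Longrightarrow> t \<in> {a..b} \<Longrightarrow> \<bar>f s - f t\<bar> \<le> M * \<bar>s - t\<bar>"
    and f: "f integrable_on {a..b}"
    and "a < b" and \<alpha>: "\<alpha> \<in> {0..1}" and \<mu>: "\<mu> \<in> {0..1}"
  shows "\<bar>\<mu> * (\<alpha> * f a + (1 - \<alpha>) * f b) + (1 - \<mu>) * f (\<alpha> * a + (1 - \<alpha>) * b)
            - 1 / (b - a) * integral {a..b} f\<bar>
     \<le> (b - a) * M *
        (((\<alpha> * \<mu>)\<^sup>2 + (1 - \<alpha> - \<alpha> * \<mu>) * \<bar>1 - \<alpha> - \<alpha> * \<mu>\<bar>) / 2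
         + ((\<mu> * (1 - \<alpha>))\<^sup>2 + (\<alpha> - \<mu> * (1 - \<alpha>)) * \<bar>\<alpha> - \<mu> * (1 - \<alpha>)\<bar>) / 2)"
    (is "\<bar>?d\<bar> \<le> _ * _ * ?F")
proof -
  define L where "L = b - a"
  define x where "x = \<alpha> * a + (1 - \<alpha>) * b"
  define u where "u = a + \<alpha> * \<mu> * L"
  define v where "v = b - \<mu> * (1 - \<alpha>) * L"
  have L: "L > 0" using \<open>a < b\<close> by (simp add: L_def)
  have "u \<le> v"
  proof -
    have "v - u = (1 - \<mu>) * L" by (simp add: u_def v_def L_def algebra_simps)
    then show ?thesis using L \<mu> by (smt (verit) atLeastAtMost_iff mult_nonneg_nonneg)
  qed
  have "a \<le> u" "v \<le> b" using L \<alpha> \<mu> by (auto simp: u_def v_def)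
  have x: "x \<in> {a..b}"
  proof -
    have "x - a = (1 - \<alpha>) * L" "b - x = \<alpha> * L" by (simp_all add: x_def L_def algebra_simps)
    then show ?thesis using L \<alpha> by (smt (verit) atLeastAtMost_iff mult_nonneg_nonneg)
  qed
  have int: "f integrable_on {c..d}" if "a \<le> c" "d \<le> b" for c d
    using integrable_subinterval_real[OF f] that by simp
  have *: "\<bar>(v - u) * f y - integral {u..v} f\<bar>
       \<le> M * (((v - y) * \<bar>v - y\<bar> - (u - y) * \<bar>u - y\<bar>) / 2)"
    if "a \<le> u" "u \<le> v" "v \<le> b" "y \<in> {a..b}" for u v y
    using lipschitz_integral_diff_le[OF lip int] that by simp
  have "integral {a..b} f = integral {a..u} f + integral {u..v} f + integral {v..b} f"
    using \<open>a \<le> u\<close> \<open>u \<le> v\<close> \<open>v \<le> b\<close> int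
      Henstock_Kurzweil_Integration.integral_combine[of a u v f]
      Henstock_Kurzweil_Integration.integral_combine[of a v b f] by simp
  \<comment> \<open>The pieces have as lengths the weights times \<open>L\<close>, so scaling by
    \<open>L\<close> matches each node value with its piece.\<close>
  moreover have "L * ?d = (u - a) * f a + (v - u) * f x + (b - v) * f b - integral {a..b} f"
    using L unfolding x_def[symmetric] L_def[symmetric]
    by (simp add: u_def v_def field_simps) (simp add: L_def algebra_simps)
  ultimately have "\<bar>L * ?d\<bar> \<le> \<bar>(u - a) * f a - integral {a..u} f\<bar>
      + \<bar>(v - u) * f x - integral {u..v} f\<bar> + \<bar>(b - v) * f b - integral {v..b} f\<bar>"
    by linarith
  also have "\<dots> \<le> M * (((u - a) * \<bar>u - a\<bar> - (a - a) * \<bar>a - a\<bar>) / 2)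
      + M * (((v - x) * \<bar>v - x\<bar> - (u - x) * \<bar>u - x\<bar>) / 2)
      + M * (((b - b) * \<bar>b - b\<bar> - (v - b) * \<bar>v - b\<bar>) / 2)"
    using \<open>a \<le> u\<close> \<open>u \<le> v\<close> \<open>v \<le> b\<close> \<open>a < b\<close> x by (intro add_mono *) auto
  also have "\<dots> = L * (L * M * ?F)"
  proof -
    \<comment> \<open>Each distance is a multiple of \<open>L\<close>. The left piece joins the part
      of the middle term at \<open>u\<close>, the right piece the part at \<open>v\<close>; these
      are the two summands of \<open>?F\<close>.\<close>
    have "u - a = \<alpha> * \<mu> * L" "v - b = - (\<mu> * (1 - \<alpha>) * L)"
      by (simp_all add: u_def v_def)
    moreover have "v - x = (\<alpha> - \<mu> * (1 - \<alpha>)) * L" "u - x = - ((1 - \<alpha> - \<alpha> * \<mu>) * L)"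
      by (simp_all add: u_def v_def x_def L_def algebra_simps)
    moreover have "\<bar>\<alpha> * \<mu>\<bar> = \<alpha> * \<mu>" "\<bar>\<mu> * (1 - \<alpha>)\<bar> = \<mu> * (1 - \<alpha>)" "\<bar>L\<bar> = L"
      using \<alpha> \<mu> L by auto
    ultimately show ?thesis
      by (simp only: abs_mult[of _ L] abs_minus_cancel)
        (simp add: power2_eq_square field_simps)
  qed
  finally have "L * \<bar>?d\<bar> \<le> L * (L * M * ?F)" using L by (simp add: abs_mult)
  then show ?thesis using L unfolding L_def by simp
qed

theorem theorem6:
  fixes I :: "real set" and f :: "real \<Rightarrow> real" and a b \<alpha> \<mu> p q A D :: real
  assumes "is_interval I"
    and "f differentiable_on interior I"
    and "a \<in> interior I" and "b \<in> interior I" and "a < b"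
    and "deriv f absolutely_integrable_on {a..b}"
    and "\<alpha> \<in> {0..1}" and "\<mu> \<in> {0..1}"
    and "q > 1" and "1 / p + 1 / q = 1"
    and "quasi_convex_on {a..b} (\<lambda>x. \<bar>deriv f x\<bar> powr q)"
    and A: "A = Sup {\<bar>deriv f a\<bar> powr q, \<bar>deriv f b\<bar> powr q}"
    and D: "D = \<bar>\<mu> * (\<alpha> * f a + (1 - \<alpha>) * f b) + (1 - \<mu>) * f (\<alpha> * a + (1 - \<alpha>) * b)
                 - 1 / (b - a) * integral {a..b} f\<bar>"
  shows "(\<alpha> * \<mu> \<le> 1 - \<alpha> \<and> 1 - \<alpha> \<le> 1 - \<mu> * (1 - \<alpha>) \<longrightarrow>
           D \<le> (b - a) * (1 / (p + 1)) powr (1 / p) * A powr (1 / q) *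
             ((1 - \<alpha>) powr (1 / q) * \<epsilon>\<^sub>1 \<alpha> \<mu> p powr (1 / p)
               + \<alpha> powr (1 / q) * \<epsilon>\<^sub>3 \<alpha> \<mu> p powr (1 / p))) \<and>
         (\<alpha> * \<mu> \<le> 1 - \<mu> * (1 - \<alpha>) \<and> 1 - \<mu> * (1 - \<alpha>) \<le> 1 - \<alpha> \<longrightarrow>
           D \<le> (b - a) * (1 / (p + 1)) powr (1 / p) * A powr (1 / q) *
             ((1 - \<alpha>) powr (1 / q) * \<epsilon>\<^sub>1 \<alpha> \<mu> p powr (1 / p)
               + \<alpha> powr (1 / q) * \<epsilon>\<^sub>4 \<alpha> \<mu> p powr (1 / p))) \<and>
         (1 - \<alpha> \<le> \<alpha> * \<mu> \<and> \<alpha> * \<mu> \<le> 1 - \<mu> * (1 - \<alpha>) \<longrightarrow>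
           D \<le> (b - a) * (1 / (p + 1)) powr (1 / p) * A powr (1 / q) *
             ((1 - \<alpha>) powr (1 / q) * \<epsilon>\<^sub>2 \<alpha> \<mu> p powr (1 / p)
               + \<alpha> powr (1 / q) * \<epsilon>\<^sub>3 \<alpha> \<mu> p powr (1 / p)))"
proof -
  have p: "p > 1"
  proof -
    have "0 < 1 / q" "1 / q < 1" using assms(9) by auto
    then have "0 < 1 / p" "1 / p < 1" using assms(10) by linarith+
    then show ?thesis by (simp add: divide_simps split: if_splits)
  qed
  have sub: "{a..b} \<subseteq> interior I"
    using assms(1,3,4)
    by (metis convex_contains_segment convex_interior is_interval_convex_1
        closed_segment_eq_real_ivl assms(5) less_imp_le)
  have der: "(f has_real_derivative deriv f x) (at x)" if "x \<in> {a..b}" for x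
    using assms(2) sub that
    by (meson DERIV_deriv_iff_real_differentiable differentiable_on_eq_differentiable_at
        open_interior subsetD)
  \<comment> \<open>The larger of the endpoint values of \<open>\<bar>deriv f\<bar>\<close>.\<close>
  define M where "M = A powr (1 / q)"
  have M: "\<bar>deriv f x\<bar> \<le> M" if "x \<in> {a..b}" for x
  proof -
    have "\<bar>deriv f x\<bar> powr q \<le> A"
      using quasi_convex_on_le_Sup_endpoints[OF assms(11) that] A by simp
    then have "(\<bar>deriv f x\<bar> powr q) powr (1 / q) \<le> A powr (1 / q)"
      using assms(9) by (intro powr_mono2) auto
    then show ?thesis using assms(9) by (simp add: M_def powr_powr)
  qed
  have lip: "\<bar>f s - f t\<bar> \<le> M * \<bar>s - t\<bar>" if "s \<in> {a..b}" "t \<in> {a..b}" for s t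
    using field_differentiable_bound[of "{a..b}" f "deriv f" M s t] der M that
    by (auto intro: has_field_derivative_at_within)
  have "continuous_on {a..b} f"
    using der by (meson DERIV_isCont continuous_at_imp_continuous_on)
  then have bound: "D \<le> (b - a) * M *
        (((\<alpha> * \<mu>)\<^sup>2 + (1 - \<alpha> - \<alpha> * \<mu>) * \<bar>1 - \<alpha> - \<alpha> * \<mu>\<bar>) / 2
         + ((\<mu> * (1 - \<alpha>))\<^sup>2 + (\<alpha> - \<mu> * (1 - \<alpha>)) * \<bar>\<alpha> - \<mu> * (1 - \<alpha>)\<bar>) / 2)"
      (is "_ \<le> _ * (?F1 + ?F2)")
    unfolding D using lip assms(5,7,8)
    by (intro lipschitz_three_point_bound integrable_continuous_real) auto
  have "(b - a) * M \<ge> 0" using assms(5) by (simp add: M_def)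
  then have combine: "D \<le> (b - a) * (1 / (p + 1)) powr (1 / p) * A powr (1 / q) * (X + Y)"
    if "?F1 \<le> (1 / (p + 1)) powr (1 / p) * X" "?F2 \<le> (1 / (p + 1)) powr (1 / p) * Y" for X Y
  proof -
    have "(b - a) * M * (?F1 + ?F2)
        \<le> (b - a) * M * ((1 / (p + 1)) powr (1 / p) * X + (1 / (p + 1)) powr (1 / p) * Y)"
      using that \<open>(b - a) * M \<ge> 0\<close> by (intro mult_left_mono add_mono)
    with bound show ?thesis by (simp add: M_def algebra_simps)
  qed
  have nonneg: "0 \<le> \<alpha> * \<mu>" "0 \<le> \<mu> * (1 - \<alpha>)" "0 \<le> \<alpha>" "0 \<le> 1 - \<alpha>"
    using assms(7,8) by auto
  note inside = holder_abs_inside[OF p assms(10)] and outside = holder_abs_outside[OF p assms(10)]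
  \<comment> \<open>Regroups the base in \<open>\<epsilon>\<^sub>2\<close> into the form
    \<open>s - c\<close> with \<open>c = 1 - \<alpha>\<close>.\<close>
  have diff: "\<alpha> * \<mu> - 1 + \<alpha> = \<alpha> * \<mu> - (1 - \<alpha>)" by simp
  show ?thesis
    \<comment> \<open>Each case fixes the order of \<open>s\<close> and \<open>c\<close> in both
      pairs: \<open>inside\<close> gives \<open>\<epsilon>\<^sub>1\<close> and
      \<open>\<epsilon>\<^sub>3\<close>, \<open>outside\<close> gives
      \<open>\<epsilon>\<^sub>2\<close> and \<open>\<epsilon>\<^sub>4\<close>. The outer terms of
      each chain settle one pair, and the inequality around \<open>1 - \<alpha>\<close> the
      other.\<close>
    unfolding \<epsilon>\<^sub>1_def \<epsilon>\<^sub>2_def \<epsilon>\<^sub>3_def \<epsilon>\<^sub>4_def diff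
    by (intro conjI impI; rule combine; rule inside outside; use nonneg in linarith)
qed

end
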